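(* Let $P$ be a countable poset. Consider the following three ways of putting a uniform structure on the set $|P|$ defined in the context: (i) the uniformity of the sup-metric $d$ induced from $[0,1]^P$; (ii) the quotient uniformity with respect to the surjection $q\colon |P_\sqcup|\to |P|$, i.e. the finest uniformity on the set $|P|$ making $q$ uniformly continuous; (iii) the uniformity of the gluing (path) pseudo-metric $$d_\infty(x,y)=\inf_{n\ge 1}\ \inf_{x=x_0,x_1,\dots,x_n=y\in |P|}\ \sum_{i=0}^{n-1} d_\sqcup\big(q^{-1}(x_i),q^{-1}(x_{i+1})\big).$$ Then $d_\infty$ is a metric on $|P|$, and the three uniformities (i), (ii), (iii) on $|P|$ coincide.
   Context: For a poset $P$, let $[0,1]^P$ be the set of all functions $P\to[0,1]$ with the metric $d(f,g)=\sup_{s\in P}|f(s)-g(s)|$. Each $p\in P$ is identified with the characteristic function of the set $\{r\in P: r\le p\}$. The set $|P|\subset[0,1]^P$ is the union of the convex hulls of all nonempty finite chains of $P$ (each chain being regarded as a finite subset of $[0,1]^P$ via this identification). For a finite chain $C=\{c_1<\dots<c_k\}$ the same construction gives the standard skew simplex $|C|=\{(x_1,\dots,x_k): 1=x_1\ge x_2\ge\dots\ge x_k\ge 0\}\subset[0,1]^k$ with the $l_\infty$ metric, whose vertex $c_i$ is $(1,\dots,1,0,\dots,0)$ ($i$ ones). $P_\sqcup$ denotes the disjoint union of all nonempty finite chains of $P$ (elements of different chains being incomparable), and $|P_\sqcup|$ is the disjoint union of the skew simplices $|C|$ over all nonempty finite chains $C$ of $P$, with the metric $d_\sqcup$ that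 is the $l_\infty$ metric on each $|C|$ and equals $1$ for points in the simplices of two different chains. The map $q\colon |P_\sqcup|\to|P|$ sends each $|C|$ affinely onto the convex hull of $C$ in $[0,1]^P$, taking each vertex $c_i$ of $|C|$ to the point $c_i$ of $|P|$. For subsets $A,B$, $d_\sqcup(A,B)=\inf_{a\in A,b\in B}d_\sqcup(a,b)$. *)

theory Defs
  imports "HOL-Analysis.Analysis" "HOL-Library.Function_Algebras"
begin

text \<open>
  The pointwise real vector space structure on functions, needed to speak of convex hulls
  of sets of functions.
\<close>

instantiation "fun" :: (type, real_vector) real_vector
begin

definition scaleR_fun :: "real \<Rightarrow> ('a \<Rightarrow> 'b) \<Rightarrow> 'a \<Rightarrow> 'b"
  where "scaleR_fun r f = (\<lambda>x. r *\<^sub>R f x)"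

instance
  by standard (auto simp: scaleR_fun_def fun_eq_iff plus_fun_def scaleR_add_left scaleR_add_right)

end

lemma scaleR_fun_apply: "(r *\<^sub>R f) x = r *\<^sub>R f x"
  by (simp add: scaleR_fun_def)

lemma sum_fun_apply: "(\<Sum>i\<in>A. f i) x = (\<Sum>i\<in>A. f i x)" for f :: "'i \<Rightarrow> 'a \<Rightarrow> 'b::comm_monoid_add"
  by (induction A rule: infinite_finite_induct) auto


section \<open>Uniform structures on a set\<close>

text \<open>
  A uniformity on \<open>X\<close> is given by its filter of entourages. The type class \<open>uniform_space\<close>
  allows one uniformity per type, on the whole type; these are its axioms relative to a set \<open>X\<close>.
  A finer uniformity is a smaller filter.
\<close>

definition uniform_structure :: "'a set \<Rightarrow> ('a \<times> 'a) filter \<Rightarrow> bool" where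
  "uniform_structure X U \<longleftrightarrow>
     U \<le> principal (X \<times> X) \<and>
     (\<forall>E. eventually E U \<longrightarrow> (\<forall>x\<in>X. E (x, x))) \<and>
     (\<forall>E. eventually E U \<longrightarrow> eventually (\<lambda>(x, y). E (y, x)) U) \<and>
     (\<forall>E. eventually E U \<longrightarrow>
        (\<exists>D. eventually D U \<and> (\<forall>x y z. D (x, y) \<longrightarrow> D (y, z) \<longrightarrow> E (x, z))))"

definition metric_uniformity :: "'a set \<Rightarrow> ('a \<Rightarrow> 'a \<Rightarrow> real) \<Rightarrow> ('a \<times> 'a) filter" where
  "metric_uniformity X d = (INF e\<in>{0<..}. principal {(x, y). x \<in> X \<and> y \<in> X \<and> d x y < e})"

definition unif_continuous :: "('a \<times> 'a) filter \<Rightarrow> ('b \<times> 'b) filter \<Rightarrow> ('a \<Rightarrow> 'b) \<Rightarrow> bool" where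
  "unif_continuous U V f \<longleftrightarrow> filterlim (\<lambda>(x, y). (f x, f y)) V U"

definition is_quotient_uniformity ::
    "('a \<times> 'a) filter \<Rightarrow> ('a \<Rightarrow> 'b) \<Rightarrow> 'b set \<Rightarrow> ('b \<times> 'b) filter \<Rightarrow> bool" where
  "is_quotient_uniformity U f Y V \<longleftrightarrow>
     uniform_structure Y V \<and> unif_continuous U V f \<and>
     (\<forall>W. uniform_structure Y W \<and> unif_continuous U W f \<longrightarrow> V \<le> W)"


section \<open>The geometric realization of a poset\<close>

text \<open>
  A poset is a subset \<open>P\<close> of a type of class \<open>order\<close> (possibly empty), with the induced order.
  A function \<open>P \<rightarrow> [0,1]\<close> is represented by its extension by \<open>0\<close> to the whole type.
\<close>

definition fin_chains :: "'a::order set \<Rightarrow> 'a set set" where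
  "fin_chains P = {C. C \<subseteq> P \<and> finite C \<and> C \<noteq> {} \<and> Complete_Partial_Order.chain (\<le>) C}"

definition vertex :: "'a::order set \<Rightarrow> 'a \<Rightarrow> 'a \<Rightarrow> real" where
  "vertex P p = indicator {r \<in> P. r \<le> p}"

definition realization :: "'a::order set \<Rightarrow> ('a \<Rightarrow> real) set" where
  "realization P = (\<Union>C\<in>fin_chains P. convex hull (vertex P ` C))"

definition sup_dist :: "'a set \<Rightarrow> ('a \<Rightarrow> real) \<Rightarrow> ('a \<Rightarrow> real) \<Rightarrow> real" where
  "sup_dist P f g = (SUP s\<in>P. \<bar>f s - g s\<bar>)"

text \<open>
  The skew simplex \<open>|C|\<close> of a finite chain \<open>C\<close> is \<open>realization C\<close>, the realization of \<open>C\<close> as a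
  poset in its own right; its points are functions on \<open>C\<close>, not on \<open>P\<close>.
\<close>

definition realization_sqcup :: "'a::order set \<Rightarrow> ('a set \<times> ('a \<Rightarrow> real)) set" where
  "realization_sqcup P = Sigma (fin_chains P) realization"

fun dist_sqcup :: "'a set \<times> ('a \<Rightarrow> real) \<Rightarrow> 'a set \<times> ('a \<Rightarrow> real) \<Rightarrow> real" where
  "dist_sqcup (C, x) (D, y) = (if C = D then sup_dist C x y else 1)"

definition setdist_sqcup ::
    "('a set \<times> ('a \<Rightarrow> real)) set \<Rightarrow> ('a set \<times> ('a \<Rightarrow> real)) set \<Rightarrow> real" where
  "setdist_sqcup A B = (INF (a, b)\<in>A \<times> B. dist_sqcup a b)"

text \<open>Barycentric coordinates of a point of the skew simplex \<open>|C|\<close>.\<close>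

definition barycentric :: "'a::order set \<Rightarrow> ('a \<Rightarrow> real) \<Rightarrow> 'a \<Rightarrow> real" where
  "barycentric C x = (THE u. (\<forall>c. c \<notin> C \<longrightarrow> u c = 0) \<and> (\<forall>c\<in>C. 0 \<le> u c) \<and> sum u C = 1 \<and>
                             x = (\<Sum>c\<in>C. u c *\<^sub>R vertex C c))"

fun quot_map :: "'a::order set \<Rightarrow> 'a set \<times> ('a \<Rightarrow> real) \<Rightarrow> 'a \<Rightarrow> real" where
  "quot_map P (C, x) = (\<Sum>c\<in>C. barycentric C x c *\<^sub>R vertex P c)"

definition quot_fibre :: "'a::order set \<Rightarrow> ('a \<Rightarrow> real) \<Rightarrow> ('a set \<times> ('a \<Rightarrow> real)) set" where
  "quot_fibre P x = {a \<in> realization_sqcup P. quot_map P a = x}"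

text \<open>
  The value \<open>0\<close> off \<open>realization P\<close> only serves to meet the convention of \<open>Metric_space\<close> that a
  metric is nonnegative and symmetric on the whole type; the infimum would be over the empty set
  there.
\<close>

definition path_dist :: "'a::order set \<Rightarrow> ('a \<Rightarrow> real) \<Rightarrow> ('a \<Rightarrow> real) \<Rightarrow> real" where
  "path_dist P x y =
     (if x \<in> realization P \<and> y \<in> realization P then
        INF n\<in>{1::nat..}.
          INF xs\<in>{xs. xs 0 = x \<and> xs n = y \<and> (\<forall>i\<le>n. xs i \<in> realization P)}.
            \<Sum>i<n. setdist_sqcup (quot_fibre P (xs i)) (quot_fibre P (xs (Suc i)))
      else 0)"


section \<open>The quotient map is the affine extension of the vertex map\<close>

lemma vertex_combination_unique:
  fixes C :: "'a::order set"
  assumes fin: "finite C"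
    and eq: "(\<Sum>c\<in>C. u c *\<^sub>R vertex C c) = (\<Sum>c\<in>C. v c *\<^sub>R vertex C c)"
    and "c \<in> C"
  shows "u c = v c"
proof (rule ccontr)
  assume "u c \<noteq> v c"
  define S where "S = {s \<in> C. u s \<noteq> v s}"
  have "finite S" "S \<noteq> {}" using fin \<open>c \<in> C\<close> \<open>u c \<noteq> v c\<close> by (auto simp: S_def)
  then obtain m where m: "m \<in> S" "\<And>s. s \<in> S \<Longrightarrow> m \<le> s \<Longrightarrow> s = m"
    by (metis finite_has_maximal)
  then have mC: "m \<in> C" by (simp add: S_def)
  have "(\<Sum>c\<in>C. (u c - v c) * vertex C c m) = 0"
    using fun_cong[OF eq, of m]
    by (simp add: sum_fun_apply scaleR_fun_apply left_diff_distrib sum_subtractf)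
  moreover have "(\<Sum>c\<in>C. (u c - v c) * vertex C c m) = (\<Sum>c\<in>{m}. (u c - v c) * vertex C c m)"
  proof (rule sum.mono_neutral_right[OF fin])
    show "{m} \<subseteq> C" using mC by simp
    show "\<forall>i\<in>C - {m}. (u i - v i) * vertex C i m = 0"
      using m(2) by (auto simp: S_def vertex_def indicator_def)
  qed
  ultimately have "u m = v m" using mC by (simp add: vertex_def)
  then show False using m(1) by (simp add: S_def)
qed

lemma inj_on_vertex: "inj_on (vertex P) C" if "C \<subseteq> P"
proof (rule inj_onI)
  fix a b assume ab: "a \<in> C" "b \<in> C" and eq: "vertex P a = vertex P b"
  have self: "vertex P c c = 1" if "c \<in> C" for c
    using that \<open>C \<subseteq> P\<close> by (auto simp: vertex_def)
  have "vertex P b a = 1" "vertex P a b = 1"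
    using self[OF ab(1)] self[OF ab(2)] eq by simp_all
  then have "a \<le> b" "b \<le> a"
    by (simp_all add: vertex_def indicator_def split: if_splits)
  then show "a = b" by simp
qed

lemma fin_chains_subset: "D \<in> fin_chains P" if "C \<in> fin_chains P" "D \<subseteq> C" "D \<noteq> {}"
  using that by (auto simp: fin_chains_def Complete_Partial_Order.chain_def intro: finite_subset)

lemma realization_chain: "realization C = convex hull (vertex C ` C)" if "C \<in> fin_chains P"
proof
  show "realization C \<subseteq> convex hull (vertex C ` C)"
    unfolding realization_def
    by (intro UN_least hull_mono image_mono) (auto simp: fin_chains_def)
  have "C \<in> fin_chains C" using that by (auto simp: fin_chains_def)
  then show "convex hull (vertex C ` C) \<subseteq> realization C"
    unfolding realization_def by blast
qed

lemma barycentric_eqI: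
  assumes "finite C" "\<And>c. c \<notin> C \<Longrightarrow> u c = 0" "\<And>c. c \<in> C \<Longrightarrow> 0 \<le> u c" "sum u C = 1"
    and "x = (\<Sum>c\<in>C. u c *\<^sub>R vertex C c)"
  shows "barycentric C x = u"
  unfolding barycentric_def
proof (rule the_equality)
  fix v assume v: "(\<forall>c. c \<notin> C \<longrightarrow> v c = 0) \<and> (\<forall>c\<in>C. 0 \<le> v c) \<and> sum v C = 1 \<and>
    x = (\<Sum>c\<in>C. v c *\<^sub>R vertex C c)"
  show "v = u"
  proof
    fix c show "v c = u c"
    proof (cases "c \<in> C")
      case True
      then show ?thesis using vertex_combination_unique[OF assms(1), of v u c] v assms(5) by simp
    next
      case False then show ?thesis using v assms(2) by simp
    qed
  qed
qed (use assms in auto)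

lemma barycentric:
  assumes C: "C \<in> fin_chains P" and x: "x \<in> realization C"
  shows "c \<notin> C \<Longrightarrow> barycentric C x c = 0"
    and "c \<in> C \<Longrightarrow> 0 \<le> barycentric C x c"
    and "sum (barycentric C x) C = 1"
    and "x = (\<Sum>c\<in>C. barycentric C x c *\<^sub>R vertex C c)"
proof -
  have fin: "finite C" using C by (simp add: fin_chains_def)
  have inj: "inj_on (vertex C) C" by (rule inj_on_vertex) simp
  obtain w where w: "\<forall>y\<in>vertex C ` C. 0 \<le> w y" "sum w (vertex C ` C) = 1"
      "(\<Sum>y\<in>vertex C ` C. w y *\<^sub>R y) = x"
    using x unfolding realization_chain[OF C] convex_hull_finite[OF finite_imageI[OF fin]] by auto
  define u where "u c = (if c \<in> C then w (vertex C c) else 0)" for c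
  have u: "\<And>c. c \<notin> C \<Longrightarrow> u c = 0" "\<And>c. c \<in> C \<Longrightarrow> 0 \<le> u c" "sum u C = 1"
      "x = (\<Sum>c\<in>C. u c *\<^sub>R vertex C c)"
    using w by (auto simp: u_def sum.reindex[OF inj])
  then have "barycentric C x = u" by (intro barycentric_eqI fin)
  with u show "c \<notin> C \<Longrightarrow> barycentric C x c = 0" "c \<in> C \<Longrightarrow> 0 \<le> barycentric C x c"
    "sum (barycentric C x) C = 1" "x = (\<Sum>c\<in>C. barycentric C x c *\<^sub>R vertex C c)"
    by simp_all
qed

lemma quot_map_vertex:
  assumes "C \<in> fin_chains P" "c \<in> C"
  shows "quot_map P (C, vertex C c) = vertex P c"
proof -
  have fin: "finite C" using assms by (simp add: fin_chains_def)
  have *: "(\<Sum>a\<in>C. (if a = c then 1 else 0) *\<^sub>R f a) = f c" for f :: "'a \<Rightarrow> 'a \<Rightarrow> real"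
  proof -
    have "(\<Sum>a\<in>C. (if a = c then 1 else 0) *\<^sub>R f a) = (\<Sum>a\<in>C. if a = c then f a else 0)"
      by (rule sum.cong) auto
    then show ?thesis using fin assms(2) by simp
  qed
  have "barycentric C (vertex C c) = (\<lambda>a. if a = c then 1 else 0)"
    using assms(2) fin * by (intro barycentric_eqI) auto
  then show ?thesis using * by simp
qed

lemma quot_map_affine:
  assumes C: "C \<in> fin_chains P" and x: "x \<in> realization C" and y: "y \<in> realization C"
    and t: "0 \<le> t" "t \<le> 1"
  shows "quot_map P (C, (1 - t) *\<^sub>R x + t *\<^sub>R y) =
           (1 - t) *\<^sub>R quot_map P (C, x) + t *\<^sub>R quot_map P (C, y)"
proof -
  note bx = barycentric[OF C x] and by' = barycentric[OF C y]
  have "barycentric C ((1 - t) *\<^sub>R x + t *\<^sub>R y) =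
          (\<lambda>c. (1 - t) * barycentric C x c + t * barycentric C y c)"
  proof (rule barycentric_eqI)
    show "(1 - t) *\<^sub>R x + t *\<^sub>R y =
      (\<Sum>c\<in>C. ((1 - t) * barycentric C x c + t * barycentric C y c) *\<^sub>R vertex C c)"
      by (subst bx(4), subst by'(4))
        (simp add: scaleR_add_left sum.distrib scaleR_sum_right)
  qed (use C t bx by' in \<open>auto simp: fin_chains_def sum.distrib simp flip: sum_distrib_left\<close>)
  then show ?thesis by (simp add: scaleR_add_left sum.distrib scaleR_sum_right)
qed

end

theory Submission
  imports Defs
begin

text \<open>
  A point \<open>x\<close> of \<open>|P|\<close> is determined by its superlevel sets \<open>{x \<ge> t}\<close>, \<open>0 < t \<le> 1\<close>, which are
  principal down-sets with generators forming a finite chain, and \<open>q\<close> is isometric on each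
  simplex. So \<open>d\<^sub>\<infinity>\<close> dominates \<open>d\<close>. Conversely suppose \<open>d x y \<le> 1 / (2n)\<close>. Round the values of \<open>x\<close>
  down to multiples of \<open>1/n\<close> and those of \<open>y\<close> to the nearest multiple. Each rounding stays in the
  original simplex, and the superlevel sets of the two rounded functions interleave:
  \<open>{x \<ge> k/n} \<subseteq> {y \<ge> (k - 1/2)/n} \<subseteq> {x \<ge> (k - 1)/n}\<close>. Hence their generators form a single
  chain, and \<open>x\<close> is joined to \<open>y\<close> by three short steps, each inside one simplex.
\<close>

section \<open>Points of a simplex and their superlevel sets\<close>

lemma mem_convex_hull_vertex_iff:
  assumes "finite C" "C \<subseteq> P"
  shows "f \<in> convex hull (vertex P ` C) \<longleftrightarrow>
    (\<exists>u. (\<forall>c\<in>C. 0 \<le> u c) \<and> sum u C = 1 \<and> f = (\<Sum>c\<in>C. u c *\<^sub>R vertex P c))"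
proof
  have inj: "inj_on (vertex P) C" using assms(2) by (rule inj_on_vertex)
  note hull = convex_hull_finite[OF finite_imageI[OF assms(1)], of "vertex P"]
  show "\<exists>u. (\<forall>c\<in>C. 0 \<le> u c) \<and> sum u C = 1 \<and> f = (\<Sum>c\<in>C. u c *\<^sub>R vertex P c)"
    if "f \<in> convex hull (vertex P ` C)"
  proof -
    from that obtain w where "\<forall>y\<in>vertex P ` C. 0 \<le> w y" "sum w (vertex P ` C) = 1"
      "(\<Sum>y\<in>vertex P ` C. w y *\<^sub>R y) = f"
      unfolding hull by auto
    then show ?thesis
      by (intro exI[of _ "w \<circ> vertex P"]) (auto simp: sum.reindex[OF inj])
  qed
  show "f \<in> convex hull (vertex P ` C)"
    if "\<exists>u. (\<forall>c\<in>C. 0 \<le> u c) \<and> sum u C = 1 \<and> f = (\<Sum>c\<in>C. u c *\<^sub>R vertex P c)"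
  proof -
    from that obtain u where u: "\<forall>c\<in>C. 0 \<le> u c" "sum u C = 1" "f = (\<Sum>c\<in>C. u c *\<^sub>R vertex P c)"
      by blast
    show ?thesis
      unfolding hull
      using u inv_into_f_f[OF inj]
      by (intro CollectI exI[of _ "u \<circ> inv_into C (vertex P)"])
        (auto simp: sum.reindex[OF inj] intro!: sum.cong)
  qed
qed

lemma combination_apply:
  "(\<Sum>c\<in>C. u c *\<^sub>R vertex P c) s = (\<Sum>c\<in>C. u c * vertex P c s)"
  by (simp add: sum_fun_apply scaleR_fun_apply)

text \<open>If some element of the chain lies above \<open>s\<close>, let \<open>b\<close> be the
  least such; then \<open>s \<le> c\<close> iff \<open>b \<le> c\<close> for all \<open>c\<close> in
  \<open>C\<close>. The vertices of \<open>C\<close> thus cannot tell \<open>s\<close> from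
  \<open>b\<close>, which reduces questions about all of \<open>P\<close> to the finite set
  \<open>C\<close>.\<close>

lemma vertex_at_chain_point:
  fixes C :: "'a::order set"
  assumes "C \<in> fin_chains P" "s \<in> P"
  obtains (none) "\<And>c. c \<in> C \<Longrightarrow> vertex P c s = 0"
    | (some) b where "b \<in> C" "s \<le> b" "\<And>c. c \<in> C \<Longrightarrow> vertex P c s = vertex P c b"
proof (cases "\<exists>c\<in>C. s \<le> c")
  case False
  then show ?thesis by (intro none) (auto simp: vertex_def)
next
  case True
  define S where "S = {c \<in> C. s \<le> c}"
  have "finite S" "S \<noteq> {}" using True assms(1) by (auto simp: S_def fin_chains_def)
  then obtain b where b: "b \<in> S" "\<And>c. c \<in> S \<Longrightarrow> c \<le> b \<Longrightarrow> c = b"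
    by (metis finite_has_minimal)
  have "b \<le> c" if "c \<in> C" "s \<le> c" for c
    using that b assms(1) by (auto simp: S_def fin_chains_def Complete_Partial_Order.chain_def)
  then show ?thesis
    using b assms by (intro some[of b])
      (auto simp: S_def vertex_def indicator_def fin_chains_def intro: order_trans)
qed

text \<open>The converse of \<open>convex_hull_vertex_level\<close>: a function is rebuilt from the
  generators of its superlevel sets by peeling off the greatest element of the chain. The total mass
  \<open>M\<close> is kept general because the remainder after one peeling has smaller mass.\<close>

lemma combination_of_levels:
  fixes f :: "'a::order \<Rightarrow> real"
  assumes "finite C" "Complete_Partial_Order.chain (\<le>) C" "C \<subseteq> P"
    and "0 \<le> M" "\<And>s. 0 \<le> f s" "\<And>s. f s \<le> M" "\<And>s. s \<notin> P \<Longrightarrow> f s = 0"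
    and "\<And>t. 0 < t \<Longrightarrow> t \<le> M \<Longrightarrow> \<exists>c\<in>C. {s \<in> P. t \<le> f s} = {s \<in> P. s \<le> c}"
  shows "\<exists>u. (\<forall>c\<in>C. 0 \<le> u c) \<and> sum u C = M \<and> (\<forall>s. f s = (\<Sum>c\<in>C. u c * vertex P c s))"
  using assms
proof (induction C arbitrary: f M rule: finite_psubset_induct)
  case (psubset C)
  note fin = psubset.hyps(1) and prems = psubset.prems
  show ?case
  proof (cases "C = {}")
    case True
    \<comment> \<open>A positive \<open>M\<close> would itself be a level, whose generator would
      have to lie in the empty chain.\<close>
    then have "M = 0" using prems(3) prems(7)[of M] by force
    then have "f s = 0" for s using prems(4,5)[of s] by simp
    with True \<open>M = 0\<close> show ?thesis by simp
  next
    case False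
    then obtain m where m: "m \<in> C" "\<And>c. c \<in> C \<Longrightarrow> m \<le> c \<Longrightarrow> c = m"
      by (metis fin finite_has_maximal)
    have le_m: "c \<le> m" if "c \<in> C" for c
      using that m prems(1) by (auto simp: Complete_Partial_Order.chain_def)
    have mP: "m \<in> P" using m prems(2) by auto
    \<comment> \<open>Among the vertices of \<open>C\<close> only that of the greatest element
      \<open>m\<close> is nonzero at \<open>m\<close>, so its coefficient can only be
      \<open>f m\<close>. Next, \<open>f\<close> is at least \<open>f m\<close> below
      \<open>m\<close> and vanishes elsewhere, so the remainder \<open>g\<close> is
      nonnegative.\<close>
    define g where "g s = f s - f m * vertex P m s" for s
    have below: "f m \<le> f s" if "s \<in> P" "s \<le> m" for s
    proof (cases "f m = 0")
      case False
      then have "0 < f m" using prems(4)[of m] by simp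
      then obtain c where c: "c \<in> C" "{s \<in> P. f m \<le> f s} = {s \<in> P. s \<le> c}"
        using prems(7) prems(5) by blast
      then have "m \<le> c" using mP by auto
      then have "s \<in> {s \<in> P. s \<le> c}" using that by (auto intro: order_trans)
      then show ?thesis unfolding c(2)[symmetric] by simp
    qed (use prems(4) in auto)
    have above: "f s = 0" if "s \<in> P" "\<not> s \<le> m" for s
    proof (rule ccontr)
      assume "f s \<noteq> 0"
      then have "0 < f s" using prems(4)[of s] by simp
      then obtain c where "c \<in> C" "{r \<in> P. f s \<le> f r} = {r \<in> P. r \<le> c}"
        using prems(7) prems(5) by blast
      then have "s \<le> c" "c \<in> C" using that by auto
      then show False using le_m that by force
    qed
    have g_alt: "g s = (if s \<in> P \<and> s \<le> m then f s - f m else 0)" for s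
      using above prems(6) by (auto simp: g_def vertex_def indicator_def)
    have "\<exists>u. (\<forall>c\<in>C - {m}. 0 \<le> u c) \<and> sum u (C - {m}) = M - f m \<and>
        (\<forall>s. g s = (\<Sum>c\<in>C - {m}. u c * vertex P c s))"
    proof (rule psubset.IH)
      show "C - {m} \<subset> C" using m by auto
      show "Complete_Partial_Order.chain (\<le>) (C - {m})"
        using prems(1) by (auto simp: Complete_Partial_Order.chain_def)
      show "C - {m} \<subseteq> P" using prems(2) by auto
      show "0 \<le> M - f m" "\<And>s. 0 \<le> g s" "\<And>s. g s \<le> M - f m" "\<And>s. s \<notin> P \<Longrightarrow> g s = 0"
        using prems(5) below by (auto simp: g_alt)
      fix t assume t: "0 < t" "t \<le> M - f m"
      then obtain c where c: "c \<in> C" "{s \<in> P. t + f m \<le> f s} = {s \<in> P. s \<le> c}"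
        using prems(7)[of "t + f m"] prems(4)[of m] by (auto simp: algebra_simps)
      \<comment> \<open>The level \<open>t + f m\<close> exceeds the value of \<open>f\<close> at
        \<open>m\<close>, so its generator survives the removal of \<open>m\<close> from the
        chain.\<close>
      have "c \<noteq> m"
      proof
        assume "c = m"
        then have "t + f m \<le> f m" using c mP by blast
        then show False using t by simp
      qed
      moreover have "t \<le> g s \<longleftrightarrow> t + f m \<le> f s" if "s \<in> P" for s
        using above[OF that] t prems(4)[of m] by (auto simp: g_alt that)
      ultimately show "\<exists>c\<in>C - {m}. {s \<in> P. t \<le> g s} = {s \<in> P. s \<le> c}"
        using c by (intro bexI[of _ c]) auto
    qed
    then obtain u where u: "\<forall>c\<in>C - {m}. 0 \<le> u c" "sum u (C - {m}) = M - f m"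
        "\<forall>s. g s = (\<Sum>c\<in>C - {m}. u c * vertex P c s)"
      by blast
    define v where "v = u(m := f m)"
    have "sum v C = M"
      using u(2) by (subst sum.remove[OF fin m(1)]) (simp add: v_def)
    moreover have "f s = (\<Sum>c\<in>C. v c * vertex P c s)" for s
    proof -
      have "(\<Sum>c\<in>C. v c * vertex P c s) = f m * vertex P m s + g s"
        using u(3) by (subst sum.remove[OF fin m(1)]) (simp add: v_def)
      then show ?thesis by (simp add: g_def)
    qed
    moreover have "\<forall>c\<in>C. 0 \<le> v c" using u(1) prems(4) by (simp add: v_def)
    ultimately show ?thesis by blast
  qed
qed

text \<open>The case of total mass 1. The condition at \<open>t = 1\<close> makes \<open>f\<close>
  attain the value 1, which is what gives the weights sum 1.\<close>

lemma mem_convex_hull_vertexI: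
  assumes "C \<in> fin_chains P" "\<And>s. 0 \<le> f s" "\<And>s. f s \<le> 1" "\<And>s. s \<notin> P \<Longrightarrow> f s = 0"
    and "\<And>t. 0 < t \<Longrightarrow> t \<le> 1 \<Longrightarrow> \<exists>c\<in>C. {s \<in> P. t \<le> f s} = {s \<in> P. s \<le> c}"
  shows "f \<in> convex hull (vertex P ` C)"
proof -
  have C: "finite C" "Complete_Partial_Order.chain (\<le>) C" "C \<subseteq> P"
    using assms(1) by (auto simp: fin_chains_def)
  have "\<exists>u. (\<forall>c\<in>C. 0 \<le> u c) \<and> sum u C = 1 \<and> (\<forall>s. f s = (\<Sum>c\<in>C. u c * vertex P c s))"
    using assms by (intro combination_of_levels[OF C]) auto
  then show ?thesis
    unfolding mem_convex_hull_vertex_iff[OF C(1,3)] fun_eq_iff combination_apply by simp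
qed

lemma convex_hull_vertex_bounds:
  assumes "C \<in> fin_chains P" "f \<in> convex hull (vertex P ` C)"
  shows "0 \<le> f s" "f s \<le> 1" "s \<notin> P \<Longrightarrow> f s = 0"
proof -
  have C: "finite C" "C \<subseteq> P" using assms(1) by (auto simp: fin_chains_def)
  obtain u where u: "\<forall>c\<in>C. 0 \<le> u c" "sum u C = 1" "f = (\<Sum>c\<in>C. u c *\<^sub>R vertex P c)"
    using assms(2) mem_convex_hull_vertex_iff[OF C] by blast
  have f: "f s = (\<Sum>c\<in>C. u c * vertex P c s)" by (simp add: u(3) combination_apply)
  show "0 \<le> f s" unfolding f using u(1) by (auto intro!: sum_nonneg simp: vertex_def)
  have "f s \<le> sum u C"
    unfolding f using u(1) by (auto intro!: sum_mono simp: vertex_def indicator_def)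
  then show "f s \<le> 1" using u(2) by simp
  show "s \<notin> P \<Longrightarrow> f s = 0" unfolding f by (simp add: vertex_def)
qed

text \<open>The function \<open>f\<close> is antitone on \<open>P\<close>, and wherever it is
  nonzero its value is also taken at an element of \<open>C\<close> lying above. Hence the greatest
  element of \<open>C\<close> at which \<open>f\<close> reaches \<open>t\<close> generates the level
  set.\<close>

lemma convex_hull_vertex_level:
  fixes P :: "'a::order set"
  assumes "C \<in> fin_chains P" "f \<in> convex hull (vertex P ` C)" "0 < t" "t \<le> 1"
  shows "\<exists>c\<in>C. {s \<in> P. t \<le> f s} = {s \<in> P. s \<le> c}"
proof -
  have C: "finite C" "C \<subseteq> P" "C \<noteq> {}" and chain: "Complete_Partial_Order.chain (\<le>) C"
    using assms(1) by (auto simp: fin_chains_def)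
  obtain u where u: "\<forall>c\<in>C. 0 \<le> u c" "sum u C = 1" "f = (\<Sum>c\<in>C. u c *\<^sub>R vertex P c)"
    using assms(2) mem_convex_hull_vertex_iff[OF C(1,2)] by blast
  have f: "f s = (\<Sum>c\<in>C. u c * vertex P c s)" for s by (simp add: u(3) combination_apply)
  have anti: "f r \<le> f s" if "s \<le> r" "s \<in> P" for r s
    unfolding f using that u(1)
    by (intro sum_mono mult_left_mono) (auto simp: vertex_def indicator_def)
  \<comment> \<open>Every vertex of \<open>C\<close> equals 1 at the least element \<open>l\<close>,
    so \<open>f l = 1\<close> and each level \<open>t \<le> 1\<close> is reached somewhere on
    \<open>C\<close>.\<close>
  obtain l where l: "l \<in> C" "\<And>c. c \<in> C \<Longrightarrow> c \<le> l \<Longrightarrow> c = l"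
    using C by (metis finite_has_minimal)
  then have "l \<le> c" if "c \<in> C" for c
    using that chain by (auto simp: Complete_Partial_Order.chain_def)
  then have "f l = sum u C"
    unfolding f using l(1) C by (intro sum.cong) (auto simp: vertex_def)
  then have "l \<in> {c \<in> C. t \<le> f c}" using u(2) assms(4) l by simp
  then obtain m where m: "m \<in> {c \<in> C. t \<le> f c}"
      "\<And>c. c \<in> {c \<in> C. t \<le> f c} \<Longrightarrow> m \<le> c \<Longrightarrow> c = m"
    using finite_has_maximal[of "{c \<in> C. t \<le> f c}"] C(1) by fastforce
  have "s \<le> m" if "s \<in> P" "t \<le> f s" for s
    using assms(1) that(1)
  proof (cases rule: vertex_at_chain_point)
    case none
    then show ?thesis using that assms(3) by (simp add: f)
  next
    case (some b)
    then have "f s = f b" by (simp add: f)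
    then have "b \<in> {c \<in> C. t \<le> f c}" using that some by simp
    then have "b \<le> m" using m chain by (auto simp: Complete_Partial_Order.chain_def)
    then show ?thesis using some by simp
  qed
  moreover have "t \<le> f s" if "s \<in> P" "s \<le> m" for s
    using anti[of s m] that m by auto
  ultimately show ?thesis using m by (intro bexI[of _ m]) auto
qed

section \<open>Joining nearby points by three short steps\<close>

text \<open>Rounding to multiples of \<open>1 / n\<close> leaves only \<open>n\<close> distinct
  conditions on superlevel sets, so any chain \<open>D\<close> containing their generators will do,
  whether or not it is the chain carrying \<open>f\<close>. The offset \<open>\<theta>\<close> is 0
  for rounding down and \<open>1/2\<close> for rounding to the nearest multiple;
  \<open>\<theta> < 1\<close> keeps the result at most 1 and fixes the value 0 off
  \<open>P\<close>.\<close>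

lemma mem_convex_hull_vertex_round:
  fixes P :: "'a::order set"
  assumes C: "C \<in> fin_chains P" "f \<in> convex hull (vertex P ` C)"
    and D: "D \<in> fin_chains P" "\<And>k::nat. 1 \<le> k \<Longrightarrow> k \<le> n \<Longrightarrow>
      \<exists>c\<in>D. {s \<in> P. (real k - \<theta>) / real n \<le> f s} = {s \<in> P. s \<le> c}"
    and "0 < n" "0 \<le> \<theta>" "\<theta> < 1"
  shows "(\<lambda>s. of_int \<lfloor>real n * f s + \<theta>\<rfloor> / real n) \<in> convex hull (vertex P ` D)"
proof (rule mem_convex_hull_vertexI[OF D(1)])
  note bounds = convex_hull_vertex_bounds[OF C]
  have n: "0 < real n" using assms by simp
  show "0 \<le> real_of_int \<lfloor>real n * f s + \<theta>\<rfloor> / real n" for s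
    using bounds[of s] assms by simp
  show "real_of_int \<lfloor>real n * f s + \<theta>\<rfloor> / real n \<le> 1" for s
  proof -
    have "real n * f s \<le> real n" using bounds[of s] n by (simp add: mult_left_le)
    then have "\<lfloor>real n * f s + \<theta>\<rfloor> \<le> int n" using assms by linarith
    then have "real_of_int \<lfloor>real n * f s + \<theta>\<rfloor> \<le> real n" by linarith
    then show ?thesis using n by simp
  qed
  show "real_of_int \<lfloor>real n * f s + \<theta>\<rfloor> / real n = 0" if "s \<notin> P" for s
  proof -
    have "\<lfloor>\<theta>\<rfloor> = 0" using assms by linarith
    then show ?thesis using bounds(3)[OF that] by simp
  qed
  fix t :: real assume t: "0 < t" "t \<le> 1"
  \<comment> \<open>A multiple of \<open>1 / n\<close> reaches \<open>t\<close> iff it reaches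
    \<open>k / n\<close> for this \<open>k\<close>, and \<open>0 < t \<le> 1\<close> places
    \<open>k\<close> between 1 and \<open>n\<close>.\<close>
  define k where "k = nat \<lceil>real n * t\<rceil>"
  have pos: "0 < real n * t" and le: "real n * t \<le> real n"
    using t n by (auto simp: mult_left_le)
  have k: "1 \<le> k" "k \<le> n" "\<lceil>real n * t\<rceil> = int k" using pos le by (auto simp: k_def) linarith+
  have "t \<le> real_of_int \<lfloor>real n * f s + \<theta>\<rfloor> / real n \<longleftrightarrow> (real k - \<theta>) / real n \<le> f s" for s
  proof -
    have "t \<le> real_of_int \<lfloor>real n * f s + \<theta>\<rfloor> / real n \<longleftrightarrow> \<lceil>real n * t\<rceil> \<le> \<lfloor>real n * f s + \<theta>\<rfloor>"
      using n by (simp add: pos_le_divide_eq ceiling_le_iff mult.commute)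
    also have "\<dots> \<longleftrightarrow> real k \<le> real n * f s + \<theta>" by (simp add: k(3) le_floor_iff)
    also have "\<dots> \<longleftrightarrow> (real k - \<theta>) / real n \<le> f s"
      using n by (simp add: pos_divide_le_eq mult.commute algebra_simps)
    finally show ?thesis .
  qed
  then show "\<exists>c\<in>D. {s \<in> P. t \<le> real_of_int \<lfloor>real n * f s + \<theta>\<rfloor> / real n} = {s \<in> P. s \<le> c}"
    using D(2)[OF k(1,2)] by simp
qed

text \<open>The difference between the floor of \<open>z + \<theta>\<close> and \<open>z\<close>
  lies above \<open>\<theta> - 1\<close> and is at most \<open>\<theta>\<close>. The bound is
  \<open>1 / n\<close> for rounding down and half of that for rounding to the nearest
  multiple.\<close>

lemma round_error:
  fixes v :: real
  assumes "0 < n" "0 \<le> \<theta>" "\<theta> < 1"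
  shows "\<bar>of_int \<lfloor>real n * v + \<theta>\<rfloor> / real n - v\<bar> \<le> max \<theta> (1 - \<theta>) / real n"
proof -
  have n: "0 < real n" using assms by simp
  have "\<bar>of_int \<lfloor>real n * v + \<theta>\<rfloor> - real n * v\<bar> \<le> max \<theta> (1 - \<theta>)" by linarith
  moreover have "of_int \<lfloor>real n * v + \<theta>\<rfloor> / real n - v = (of_int \<lfloor>real n * v + \<theta>\<rfloor> - real n * v) / real n"
    using n by (simp add: field_simps)
  ultimately show ?thesis using n by (simp add: abs_divide divide_right_mono)
qed

text \<open>One short step inside a single simplex, expressed through values on \<open>P\<close> so
  that the rounding argument needs no points of the disjoint union. Such a step lifts along
  \<open>q\<close> by \<open>close_in_simplex_lift\<close>.\<close>

definition close_in_simplex :: "'a::order set \<Rightarrow> real \<Rightarrow> ('a \<Rightarrow> real) \<Rightarrow> ('a \<Rightarrow> real) \<Rightarrow> bool" where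
  "close_in_simplex P e x y \<longleftrightarrow> (\<exists>C\<in>fin_chains P. x \<in> convex hull (vertex P ` C) \<and>
     y \<in> convex hull (vertex P ` C) \<and> (\<forall>s\<in>P. \<bar>x s - y s\<bar> \<le> e))"

lemma three_steps:
  fixes P :: "'a::order set"
  assumes "x \<in> realization P" "y \<in> realization P" "0 < n"
    and close: "\<And>s. s \<in> P \<Longrightarrow> \<bar>x s - y s\<bar> \<le> 1 / (2 * real n)"
  shows "\<exists>x' y'. close_in_simplex P (2 / real n) x x' \<and> close_in_simplex P (2 / real n) x' y' \<and>
    close_in_simplex P (2 / real n) y' y"
proof -
  have n: "0 < real n" using assms by simp
  obtain A where A: "A \<in> fin_chains P" "x \<in> convex hull (vertex P ` A)"
    using assms(1) by (auto simp: realization_def)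
  obtain B where B: "B \<in> fin_chains P" "y \<in> convex hull (vertex P ` B)"
    using assms(2) by (auto simp: realization_def)
  \<comment> \<open>The summand 0 keeps both roundings in the form with offset
    \<open>\<theta>\<close>. The different offsets 0 and \<open>1/2\<close> are what make the two
    families of level sets interleave.\<close>
  define x' where "x' s = of_int \<lfloor>real n * x s + 0\<rfloor> / real n" for s
  define y' where "y' s = of_int \<lfloor>real n * y s + 1/2\<rfloor> / real n" for s
  have levA: "\<exists>c\<in>A. {s \<in> P. (real k - 0) / real n \<le> x s} = {s \<in> P. s \<le> c}"
    if "1 \<le> k" "k \<le> n" for k :: nat
    using that n by (intro convex_hull_vertex_level[OF A]) auto
  have levB: "\<exists>c\<in>B. {s \<in> P. (real k - 1/2) / real n \<le> y s} = {s \<in> P. s \<le> c}"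
    if "1 \<le> k" "k \<le> n" for k :: nat
    using that n by (intro convex_hull_vertex_level[OF B]) auto
  have x'A: "x' \<in> convex hull (vertex P ` A)"
    unfolding x'_def by (rule mem_convex_hull_vertex_round[OF A A(1) levA]) (use assms in auto)
  have y'B: "y' \<in> convex hull (vertex P ` B)"
    unfolding y'_def by (rule mem_convex_hull_vertex_round[OF B B(1) levB]) (use assms in auto)
  obtain a where a: "\<And>k. 1 \<le> k \<Longrightarrow> k \<le> n \<Longrightarrow>
      a k \<in> A \<and> {s \<in> P. (real k - 0) / real n \<le> x s} = {s \<in> P. s \<le> a k}"
    using levA by metis
  obtain b where b: "\<And>k. 1 \<le> k \<Longrightarrow> k \<le> n \<Longrightarrow>
      b k \<in> B \<and> {s \<in> P. (real k - 1/2) / real n \<le> y s} = {s \<in> P. s \<le> b k}"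
    using levB by metis
  have aP: "a k \<in> P" and bP: "b k \<in> P" if "1 \<le> k" "k \<le> n" for k
    using a[OF that] b[OF that] A(1) B(1) by (auto simp: fin_chains_def)
  have xa: "real k / real n \<le> x (a k)" and yb: "(real k - 1/2) / real n \<le> y (b k)"
    if "1 \<le> k" "k \<le> n" for k
    using a[OF that] b[OF that] aP[OF that] bP[OF that] by auto
  have le_a: "s \<le> a k" if "1 \<le> k" "k \<le> n" "s \<in> P" "real k / real n \<le> x s" for s k
    using a[OF that(1,2)] that by auto
  have le_b: "s \<le> b k" if "1 \<le> k" "k \<le> n" "s \<in> P" "(real k - 1/2) / real n \<le> y s" for s k
    using b[OF that(1,2)] that by auto
  \<comment> \<open>The four families of inequalities that follow arrange all generators as \<open>a
    n \<le> b n \<le> a (n - 1) \<le> b (n - 1) \<le> ... \<le> a 1 \<le> b 1\<close>.\<close>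
  have aa: "a k \<le> a j" if "1 \<le> j" "j \<le> k" "k \<le> n" for j k
  proof (rule le_a)
    have "real j / real n \<le> real k / real n" using that n by (simp add: divide_right_mono)
    then show "real j / real n \<le> x (a k)" using xa[of k] that by simp
  qed (use that aP in auto)
  have ab: "a k \<le> b j" if "1 \<le> j" "j \<le> k" "k \<le> n" for j k
  proof (rule le_b)
    have "(real j - 1/2) / real n \<le> (real k - 1/2) / real n"
      using that n by (simp add: divide_right_mono)
    also have "\<dots> = real k / real n - 1 / (2 * real n)" by (simp add: diff_divide_distrib)
    also have "\<dots> \<le> y (a k)" using xa[of k] close[OF aP[of k]] that by auto
    finally show "(real j - 1/2) / real n \<le> y (a k)" .
  qed (use that aP in auto)
  \<comment> \<open>The value of \<open>y\<close> at \<open>b k\<close> is already half a step below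
    \<open>k / n\<close>, and passing to \<open>x\<close> loses another half step. The index
    therefore drops by one, whence \<open>j < k\<close> here against \<open>j \<le> k\<close> in
    \<open>ab\<close>.\<close>
  have ba: "b k \<le> a j" if "1 \<le> j" "j < k" "k \<le> n" for j k
  proof (rule le_a)
    have "real j / real n \<le> (real k - 1) / real n" using that n by (simp add: divide_right_mono)
    also have "\<dots> = (real k - 1/2) / real n - 1 / (2 * real n)" using n by (simp add: field_simps)
    also have "\<dots> \<le> x (b k)" using yb[of k] close[OF bP[of k]] that by auto
    finally show "real j / real n \<le> x (b k)" .
  qed (use that bP in auto)
  have bb: "b k \<le> b j" if "1 \<le> j" "j \<le> k" "k \<le> n" for j k
  proof (rule le_b)
    have "(real j - 1/2) / real n \<le> (real k - 1/2) / real n"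
      using that n by (simp add: divide_right_mono)
    then show "(real j - 1/2) / real n \<le> y (b k)" using yb[of k] that by simp
  qed (use that bP in auto)
  \<comment> \<open>This chain carries both rounded functions and so supports the middle step. It is
    finite because only \<open>n\<close> levels of each function matter.\<close>
  define D where "D = a ` {1..n} \<union> b ` {1..n}"
  have comparable: "a i \<le> a j \<or> a j \<le> a i" "b i \<le> b j \<or> b j \<le> b i"
      "a i \<le> b j \<or> b j \<le> a i" "b j \<le> a i \<or> a i \<le> b j"
    if "i \<in> {1..n}" "j \<in> {1..n}" for i j
  proof -
    have ij: "1 \<le> i" "i \<le> n" "1 \<le> j" "j \<le> n" using that by auto
    show "a i \<le> a j \<or> a j \<le> a i" "b i \<le> b j \<or> b j \<le> b i"
      using aa[OF ij(1) _ ij(4)] aa[OF ij(3) _ ij(2)] bb[OF ij(1) _ ij(4)] bb[OF ij(3) _ ij(2)]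
        nat_le_linear[of i j] by blast+
    show "a i \<le> b j \<or> b j \<le> a i" "b j \<le> a i \<or> a i \<le> b j"
      using ab[OF ij(3) _ ij(2)] ba[OF ij(1) _ ij(4)] le_less_linear[of j i] by blast+
  qed
  have "u \<le> v \<or> v \<le> u" if "u \<in> D" "v \<in> D" for u v
    using that unfolding D_def by (elim UnE imageE; hypsubst) (rule comparable; assumption)+
  then have "Complete_Partial_Order.chain (\<le>) D"
    unfolding Complete_Partial_Order.chain_def by blast
  then have D: "D \<in> fin_chains P"
    using aP bP assms(3) by (auto simp: fin_chains_def D_def)
  have x'D: "x' \<in> convex hull (vertex P ` D)"
    unfolding x'_def
  proof (rule mem_convex_hull_vertex_round[OF A D])
    show "\<exists>c\<in>D. {s \<in> P. (real k - 0) / real n \<le> x s} = {s \<in> P. s \<le> c}"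
      if "1 \<le> k" "k \<le> n" for k
      using a[OF that] that by (intro bexI[of _ "a k"]) (auto simp: D_def)
  qed (use assms in auto)
  have y'D: "y' \<in> convex hull (vertex P ` D)"
    unfolding y'_def
  proof (rule mem_convex_hull_vertex_round[OF B D])
    show "\<exists>c\<in>D. {s \<in> P. (real k - 1/2) / real n \<le> y s} = {s \<in> P. s \<le> c}"
      if "1 \<le> k" "k \<le> n" for k
      using b[OF that] that by (intro bexI[of _ "b k"]) (auto simp: D_def)
  qed (use assms in auto)
  \<comment> \<open>In units of \<open>p\<close>, rounding \<open>x\<close> costs at most 2,
    rounding \<open>y\<close> at most 1, and \<open>x\<close> and \<open>y\<close> differ by at most
    1. The middle step is the longest, at most \<open>2 * p + p + p\<close>, which is the bound
    \<open>2 / n\<close>.\<close>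
  define p where "p = 1 / (2 * real n)"
  have p: "0 \<le> p" "1 / real n = 2 * p" "2 / real n = 4 * p"
    using n by (simp_all add: p_def)
  have xx': "\<bar>x' s - x s\<bar> \<le> 2 * p" and yy': "\<bar>y' s - y s\<bar> \<le> p" for s
    using round_error[OF assms(3), of 0 "x s"] round_error[OF assms(3), of "1/2" "y s"]
    unfolding x'_def y'_def p(2)[symmetric] by (simp_all add: p_def)
  have "close_in_simplex P (2 / real n) x x'"
    unfolding close_in_simplex_def p(3)
  proof (intro bexI[OF _ A(1)] conjI A(2) x'A ballI)
    show "\<bar>x s - x' s\<bar> \<le> 4 * p" for s
      using xx'[of s] p(1) by linarith
  qed
  moreover have "close_in_simplex P (2 / real n) y' y"
    unfolding close_in_simplex_def p(3)
  proof (intro bexI[OF _ B(1)] conjI B(2) y'B ballI)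
    show "\<bar>y' s - y s\<bar> \<le> 4 * p" for s
      using yy'[of s] p(1) by linarith
  qed
  moreover have "close_in_simplex P (2 / real n) x' y'"
    unfolding close_in_simplex_def p(3)
  proof (intro bexI[OF _ D] conjI x'D y'D ballI)
    show "\<bar>x' s - y' s\<bar> \<le> 4 * p" if "s \<in> P" for s
      using xx'[of s] yy'[of s] close[OF that] unfolding p_def[symmetric] by linarith
  qed
  ultimately show ?thesis by blast
qed

lemma close_in_simplex_realization:
  assumes "close_in_simplex P e x y"
  shows "x \<in> realization P" "y \<in> realization P"
  using assms by (auto simp: close_in_simplex_def realization_def)

section \<open>The sup-metric and the distance between fibres\<close>

lemma realization_bounds:
  assumes "x \<in> realization P"
  shows "0 \<le> x s" "x s \<le> 1" "s \<notin> P \<Longrightarrow> x s = 0"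
  using assms convex_hull_vertex_bounds unfolding realization_def by blast+

text \<open>Guarantees that the supremum in \<open>sup_dist\<close> is taken over a nonempty
  set.\<close>

lemma realization_nonempty:
  "P \<noteq> {}" if "x \<in> realization P"
  using that by (auto simp: realization_def fin_chains_def)

lemma sup_dist_upper:
  assumes "x \<in> realization P" "y \<in> realization P" "s \<in> P"
  shows "\<bar>x s - y s\<bar> \<le> sup_dist P x y"
  unfolding sup_dist_def
proof (rule cSUP_upper[OF assms(3)])
  have "\<bar>x s - y s\<bar> \<le> 1" for s
    using realization_bounds[OF assms(1), of s] realization_bounds[OF assms(2), of s] by linarith
  then show "bdd_above ((\<lambda>s. \<bar>x s - y s\<bar>) ` P)" by (intro bdd_aboveI2)
qed

lemma sup_dist_least:
  assumes "x \<in> realization P" "\<And>s. s \<in> P \<Longrightarrow> \<bar>x s - y s\<bar> \<le> e"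
  shows "sup_dist P x y \<le> e"
  unfolding sup_dist_def using realization_nonempty[OF assms(1)] assms(2) by (rule cSUP_least)

lemma sup_dist_le_one:
  assumes "x \<in> realization P" "y \<in> realization P"
  shows "sup_dist P x y \<le> 1"
proof (rule sup_dist_least[OF assms(1)])
  show "\<bar>x s - y s\<bar> \<le> 1" for s
    using realization_bounds[OF assms(1), of s] realization_bounds[OF assms(2), of s] by linarith
qed

lemma sup_dist_commute: "sup_dist P x y = sup_dist P y x"
  by (simp add: sup_dist_def abs_minus_commute)

lemma sup_dist_nonneg:
  assumes "x \<in> realization P" "y \<in> realization P"
  shows "0 \<le> sup_dist P x y"
proof -
  obtain s where "s \<in> P" using realization_nonempty[OF assms(1)] by blast
  from sup_dist_upper[OF assms this] show ?thesis by linarith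
qed

lemma sup_dist_self: "sup_dist P x x = 0" if "x \<in> realization P"
  using sup_dist_nonneg[OF that that] sup_dist_least[OF that, of x 0] by simp

lemma sup_dist_triangle:
  assumes "x \<in> realization P" "y \<in> realization P" "z \<in> realization P"
  shows "sup_dist P x z \<le> sup_dist P x y + sup_dist P y z"
proof (rule sup_dist_least[OF assms(1)])
  show "\<bar>x s - z s\<bar> \<le> sup_dist P x y + sup_dist P y z" if "s \<in> P" for s
    using sup_dist_upper[OF assms(1,2) that] sup_dist_upper[OF assms(2,3) that] by linarith
qed

text \<open>Agreement on \<open>P\<close> is enough, since points of the realization are extended by
  0 off \<open>P\<close>.\<close>

lemma sup_dist_eq_0:
  assumes "x \<in> realization P" "y \<in> realization P" "sup_dist P x y \<le> 0"
  shows "x = y"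
proof
  fix s show "x s = y s"
  proof (cases "s \<in> P")
    case True
    then show ?thesis using sup_dist_upper[OF assms(1,2) True] assms(3) by linarith
  qed (use assms(1,2) in \<open>simp add: realization_bounds(3)\<close>)
qed

section \<open>The quotient map is isometric on each simplex\<close>

lemma quot_map_apply:
  assumes "C \<in> fin_chains P" "u \<in> realization C"
  shows "quot_map P (C, u) s = (\<Sum>c\<in>C. barycentric C u c * vertex P c s)"
  by (simp add: combination_apply)

lemma quot_map_mem:
  assumes "C \<in> fin_chains P" "u \<in> realization C"
  shows "quot_map P (C, u) \<in> convex hull (vertex P ` C)"
proof -
  have C: "finite C" "C \<subseteq> P" using assms(1) by (auto simp: fin_chains_def)
  show ?thesis
    unfolding mem_convex_hull_vertex_iff[OF C]
    using barycentric[OF assms] by (intro exI[of _ "barycentric C u"]) auto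
qed

lemma quot_map_realization:
  assumes "a \<in> realization_sqcup P"
  shows "quot_map P a \<in> realization P"
proof -
  obtain C u where a: "a = (C, u)" "C \<in> fin_chains P" "u \<in> realization C"
    using assms by (auto simp: realization_sqcup_def)
  then show ?thesis using quot_map_mem[OF a(2,3)] unfolding realization_def by blast
qed

text \<open>On \<open>C\<close> the vertices formed in \<open>C\<close> and in \<open>P\<close>
  agree, so \<open>q\<close> merely extends \<open>u\<close> from \<open>C\<close> to the whole
  poset.\<close>

lemma quot_map_on_chain:
  assumes "C \<in> fin_chains P" "u \<in> realization C" "c \<in> C"
  shows "quot_map P (C, u) c = u c"
proof -
  have "u c = (\<Sum>b\<in>C. barycentric C u b * vertex C b c)"
    by (subst barycentric(4)[OF assms(1,2)]) (rule combination_apply)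
  also have "\<dots> = (\<Sum>b\<in>C. barycentric C u b * vertex P b c)"
    using assms by (intro sum.cong) (auto simp: vertex_def indicator_def fin_chains_def)
  finally show ?thesis unfolding quot_map_apply[OF assms(1,2)] by (rule sym)
qed

text \<open>At each point of \<open>P\<close> the two images either both vanish or take their values
  at a common point of \<open>C\<close>. Enlarging the domain from \<open>C\<close> to
  \<open>P\<close> therefore creates no larger differences, and \<open>C \<subseteq> P\<close> gives
  the reverse inequality.\<close>

lemma sup_dist_quot_map:
  assumes C: "C \<in> fin_chains P" and u: "u \<in> realization C" and v: "v \<in> realization C"
  shows "sup_dist P (quot_map P (C, u)) (quot_map P (C, v)) = sup_dist C u v"
proof (rule antisym)
  have R: "quot_map P (C, u) \<in> realization P" "quot_map P (C, v) \<in> realization P"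
    using assms by (auto intro!: quot_map_realization simp: realization_sqcup_def simp del: quot_map.simps)
  show "sup_dist P (quot_map P (C, u)) (quot_map P (C, v)) \<le> sup_dist C u v"
  proof (rule sup_dist_least[OF R(1)])
    fix s assume "s \<in> P"
    with C show "\<bar>quot_map P (C, u) s - quot_map P (C, v) s\<bar> \<le> sup_dist C u v"
    proof (cases rule: vertex_at_chain_point)
      case none
      then show ?thesis
        using sup_dist_nonneg[OF u v]
        by (simp add: quot_map_apply[OF C u] quot_map_apply[OF C v] del: quot_map.simps)
    next
      case (some b)
      then have "quot_map P (C, w) s = w b" if "w \<in> realization C" for w
        using quot_map_on_chain[OF C that some(1)]
        by (simp add: quot_map_apply[OF C that] del: quot_map.simps)
      then show ?thesis using u v sup_dist_upper[OF u v some(1)] by (simp del: quot_map.simps)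
    qed
  qed
  show "sup_dist C u v \<le> sup_dist P (quot_map P (C, u)) (quot_map P (C, v))"
  proof (rule sup_dist_least[OF u])
    fix c assume c: "c \<in> C"
    then have "c \<in> P" using C by (auto simp: fin_chains_def)
    from sup_dist_upper[OF R this]
    show "\<bar>u c - v c\<bar> \<le> sup_dist P (quot_map P (C, u)) (quot_map P (C, v))"
      by (simp add: quot_map_on_chain[OF C _ c] u v del: quot_map.simps)
  qed
qed

lemma quot_map_lift:
  assumes "C \<in> fin_chains P" "x \<in> convex hull (vertex P ` C)"
  obtains u where "u \<in> realization C" "quot_map P (C, u) = x"
proof -
  have C: "finite C" "C \<subseteq> P" using assms(1) by (auto simp: fin_chains_def)
  obtain w where w: "\<forall>c\<in>C. 0 \<le> w c" "sum w C = 1" "x = (\<Sum>c\<in>C. w c *\<^sub>R vertex P c)"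
    using assms(2) mem_convex_hull_vertex_iff[OF C] by blast
  \<comment> \<open>\<open>barycentric\<close> is normalized to vanish off \<open>C\<close>, so the
    weights are cut off there before being compared with it.\<close>
  define w' where "w' c = (if c \<in> C then w c else 0)" for c
  define u where "u = (\<Sum>c\<in>C. w' c *\<^sub>R vertex C c)"
  have w': "\<forall>c\<in>C. 0 \<le> w' c" "sum w' C = 1" "x = (\<Sum>c\<in>C. w' c *\<^sub>R vertex P c)"
    using w by (simp_all add: w'_def)
  have "barycentric C u = w'"
    using w' by (intro barycentric_eqI C(1)) (auto simp: w'_def u_def)
  then have "quot_map P (C, u) = x" by (simp add: w'(3))
  moreover have "u \<in> realization C"
    unfolding realization_chain[OF assms(1)] mem_convex_hull_vertex_iff[OF C(1) subset_refl]
    using w' u_def by blast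
  ultimately show ?thesis using that by blast
qed

section \<open>Distances between fibres of the quotient map\<close>

lemma dist_sqcup_commute: "dist_sqcup a b = dist_sqcup b a"
  by (cases a; cases b) (simp add: sup_dist_commute)

lemma setdist_sqcup_commute: "setdist_sqcup A B = setdist_sqcup B A"
proof -
  have "(\<lambda>(a, b). dist_sqcup a b) \<circ> prod.swap = (\<lambda>(a, b). dist_sqcup a b)"
    by (rule ext, unfold comp_def split_beta fst_swap snd_swap) (rule dist_sqcup_commute)
  then have "(\<lambda>(a, b). dist_sqcup a b) ` (A \<times> B) = (\<lambda>(a, b). dist_sqcup a b) ` (B \<times> A)"
    by (metis image_comp product_swap)
  then show ?thesis by (simp add: setdist_sqcup_def)
qed

text \<open>Within one simplex \<open>q\<close> is isometric; across different simplices the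
  distance is 1, while the realization has diameter at most 1.\<close>

lemma sup_dist_le_dist_sqcup:
  assumes "a \<in> realization_sqcup P" "b \<in> realization_sqcup P"
  shows "sup_dist P (quot_map P a) (quot_map P b) \<le> dist_sqcup a b"
proof -
  obtain C u D v where ab: "a = (C, u)" "b = (D, v)" by (cases a; cases b) auto
  show ?thesis
  proof (cases "C = D")
    case True
    then show ?thesis
      using sup_dist_quot_map[of C P u v] assms
      by (simp add: ab realization_sqcup_def del: quot_map.simps)
  next
    case False
    then show ?thesis
      using sup_dist_le_one[OF quot_map_realization[OF assms(1)] quot_map_realization[OF assms(2)]]
      by (simp add: ab del: quot_map.simps)
  qed
qed

text \<open>Surjectivity of \<open>q\<close>; it ensures that the infimum in
  \<open>setdist_sqcup\<close> is over a nonempty set.\<close>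

lemma quot_fibre_nonempty:
  assumes "x \<in> realization P"
  shows "quot_fibre P x \<noteq> {}"
proof -
  obtain C where C: "C \<in> fin_chains P" "x \<in> convex hull (vertex P ` C)"
    using assms unfolding realization_def by blast
  obtain u where "u \<in> realization C" "quot_map P (C, u) = x" using quot_map_lift[OF C] .
  then have "(C, u) \<in> quot_fibre P x" using C by (simp add: quot_fibre_def realization_sqcup_def)
  then show ?thesis by blast
qed

lemma sup_dist_le_quot_fibre:
  assumes "a \<in> quot_fibre P x" "b \<in> quot_fibre P y"
  shows "sup_dist P x y \<le> dist_sqcup a b"
  using assms sup_dist_le_dist_sqcup[of a P b] by (auto simp: quot_fibre_def simp del: quot_map.simps)

lemma sup_dist_le_setdist_sqcup:
  assumes "x \<in> realization P" "y \<in> realization P"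
  shows "sup_dist P x y \<le> setdist_sqcup (quot_fibre P x) (quot_fibre P y)"
  unfolding setdist_sqcup_def
  using quot_fibre_nonempty[OF assms(1)] quot_fibre_nonempty[OF assms(2)]
  by (intro cINF_greatest) (auto intro: sup_dist_le_quot_fibre simp del: dist_sqcup.simps)

lemma setdist_sqcup_le:
  assumes "a \<in> quot_fibre P x" "b \<in> quot_fibre P y"
  shows "setdist_sqcup (quot_fibre P x) (quot_fibre P y) \<le> dist_sqcup a b"
  unfolding setdist_sqcup_def
proof (rule cINF_lower2)
  show "bdd_below ((\<lambda>(a, b). dist_sqcup a b) ` (quot_fibre P x \<times> quot_fibre P y))"
    by (intro bdd_belowI2[of _ "sup_dist P x y"])
      (auto intro: sup_dist_le_quot_fibre simp del: dist_sqcup.simps)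
qed (use assms in auto)

lemma close_in_simplex_lift:
  assumes "close_in_simplex P e x y"
  obtains a b where "a \<in> quot_fibre P x" "b \<in> quot_fibre P y" "dist_sqcup a b \<le> e"
proof -
  obtain C where C: "C \<in> fin_chains P" and xy: "x \<in> convex hull (vertex P ` C)"
      "y \<in> convex hull (vertex P ` C)" and e: "\<And>s. s \<in> P \<Longrightarrow> \<bar>x s - y s\<bar> \<le> e"
    using assms by (auto simp: close_in_simplex_def)
  obtain u where u: "u \<in> realization C" "quot_map P (C, u) = x" using quot_map_lift[OF C xy(1)] .
  obtain v where v: "v \<in> realization C" "quot_map P (C, v) = y" using quot_map_lift[OF C xy(2)] .
  have "sup_dist P x y \<le> e"
    using sup_dist_least[OF close_in_simplex_realization(1)[OF assms] e] .
  then have "dist_sqcup (C, u) (C, v) \<le> e"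
    using sup_dist_quot_map[OF C u(1) v(1)] u v by simp
  moreover have "(C, u) \<in> quot_fibre P x" "(C, v) \<in> quot_fibre P y"
    using C u v by (simp_all add: quot_fibre_def realization_sqcup_def)
  ultimately show ?thesis using that by blast
qed

section \<open>The path metric\<close>

text \<open>Replaces the nested infima by an actual path. Since \<open>Inf\<close> on the reals is
  only conditionally complete, both index sets must be nonempty and the lengths bounded below by
  0.\<close>

lemma path_dist_less_iff:
  assumes "x \<in> realization P" "y \<in> realization P"
  shows "path_dist P x y < r \<longleftrightarrow>
    (\<exists>n\<ge>1. \<exists>xs. xs 0 = x \<and> xs n = y \<and> (\<forall>i\<le>n. xs i \<in> realization P) \<and>
      (\<Sum>i<n. setdist_sqcup (quot_fibre P (xs i)) (quot_fibre P (xs (Suc i)))) < r)"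
proof -
  define len where
    "len n xs = (\<Sum>i<n. setdist_sqcup (quot_fibre P (xs i)) (quot_fibre P (xs (Suc i))))"
    for n :: nat and xs :: "nat \<Rightarrow> 'a \<Rightarrow> real"
  define paths where
    "paths n = {xs. xs 0 = x \<and> xs n = y \<and> (\<forall>i\<le>n. xs i \<in> realization P)}" for n :: nat
  have nonneg: "0 \<le> len n xs" if "xs \<in> paths n" for n xs
    unfolding len_def
  proof (rule sum_nonneg)
    fix i assume "i \<in> {..<n}"
    then have "xs i \<in> realization P" "xs (Suc i) \<in> realization P"
      using that by (auto simp: paths_def)
    then show "0 \<le> setdist_sqcup (quot_fibre P (xs i)) (quot_fibre P (xs (Suc i)))"
      using sup_dist_nonneg sup_dist_le_setdist_sqcup order_trans by blast
  qed
  have ne: "paths n \<noteq> {}" if "1 \<le> n" for n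
  proof -
    have "(\<lambda>i. if i = 0 then x else y) \<in> paths n" using assms that by (auto simp: paths_def)
    then show ?thesis by blast
  qed
  have bdd: "bdd_below (len n ` paths n)" for n using nonneg by (intro bdd_belowI2)
  have "path_dist P x y = (INF n\<in>{1..}. INF xs\<in>paths n. len n xs)"
    using assms by (simp add: path_dist_def len_def paths_def)
  moreover have "bdd_below ((\<lambda>n. INF xs\<in>paths n. len n xs) ` {1..})"
    using ne nonneg by (intro bdd_belowI2[of _ 0] cINF_greatest) auto
  ultimately have "path_dist P x y < r \<longleftrightarrow> (\<exists>n\<in>{1..}. (INF xs\<in>paths n. len n xs) < r)"
    by (simp add: cINF_less_iff)
  also have "\<dots> \<longleftrightarrow> (\<exists>n\<ge>1. \<exists>xs\<in>paths n. len n xs < r)"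
    using ne bdd by (auto simp: cINF_less_iff)
  finally show ?thesis unfolding paths_def len_def by auto
qed

text \<open>Each step is at least as long as the sup-distance of its endpoints, so the triangle
  inequality along initial segments bounds the length of every path from below.\<close>

lemma sup_dist_le_path_dist:
  assumes "x \<in> realization P" "y \<in> realization P"
  shows "sup_dist P x y \<le> path_dist P x y"
proof (rule ccontr)
  assume "\<not> ?thesis"
  then obtain n xs where xs: "xs 0 = x" "xs n = y" "\<And>i. i \<le> n \<Longrightarrow> xs i \<in> realization P"
    and less: "(\<Sum>i<n. setdist_sqcup (quot_fibre P (xs i)) (quot_fibre P (xs (Suc i)))) < sup_dist P x y"
    using path_dist_less_iff[OF assms] by (auto simp: not_le)
  have "sup_dist P (xs 0) (xs k) \<le>
      (\<Sum>i<k. setdist_sqcup (quot_fibre P (xs i)) (quot_fibre P (xs (Suc i))))" if "k \<le> n" for k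
    using that
  proof (induction k)
    case 0
    then show ?case using sup_dist_self[OF assms(1)] xs(1) by simp
  next
    case (Suc k)
    then show ?case
      using sup_dist_triangle[of "xs 0" P "xs k" "xs (Suc k)"]
        sup_dist_le_setdist_sqcup[of "xs k" P "xs (Suc k)"] xs(3) by fastforce
  qed
  from this[of n] less xs show False by simp
qed

lemma path_dist_le_setdist_sqcup:
  assumes "x \<in> realization P" "y \<in> realization P"
  shows "path_dist P x y \<le> setdist_sqcup (quot_fibre P x) (quot_fibre P y)"
proof (rule dense_ge)
  fix r assume "setdist_sqcup (quot_fibre P x) (quot_fibre P y) < r"
  then have "path_dist P x y < r"
    unfolding path_dist_less_iff[OF assms] using assms
    \<comment> \<open>The witness is the path with a single step from \<open>x\<close> to
      \<open>y\<close>.\<close>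
    by (intro exI[of _ "1::nat"] conjI exI[of _ "\<lambda>i. if i = 0 then x else y"]) auto
  then show "path_dist P x y \<le> r" by simp
qed

text \<open>Reversing a path preserves its length. Symmetry extends to all functions thanks to the
  default value 0 off the realization.\<close>

lemma path_dist_commute: "path_dist P x y = path_dist P y x"
proof -
  have le: "path_dist P x y \<le> path_dist P y x" if R: "x \<in> realization P" "y \<in> realization P" for x y
  proof (rule dense_ge)
    fix r assume "path_dist P y x < r"
    then obtain n xs where n: "1 \<le> n" and xs: "xs 0 = y" "xs n = x" "\<forall>i\<le>n. xs i \<in> realization P"
      and less: "(\<Sum>i<n. setdist_sqcup (quot_fibre P (xs i)) (quot_fibre P (xs (Suc i)))) < r"
      unfolding path_dist_less_iff[OF R(2,1)] by blast
    have "(\<Sum>i<n. setdist_sqcup (quot_fibre P (xs i)) (quot_fibre P (xs (Suc i)))) =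
        (\<Sum>i<n. setdist_sqcup (quot_fibre P (xs (n - i))) (quot_fibre P (xs (n - Suc i))))"
      by (subst sum.nat_diff_reindex[symmetric], rule sum.cong)
        (auto simp: Suc_diff_Suc setdist_sqcup_commute)
    then have "path_dist P x y < r"
      unfolding path_dist_less_iff[OF R] using n xs less
      by (intro exI[of _ n] conjI exI[of _ "\<lambda>i. xs (n - i)"]) auto
    then show "path_dist P x y \<le> r" by simp
  qed
  show ?thesis
  proof (cases "x \<in> realization P \<and> y \<in> realization P")
    case True
    then show ?thesis using le[of x y] le[of y x] by simp
  qed (auto simp: path_dist_def)
qed

lemma path_dist_triangle:
  assumes R: "x \<in> realization P" "y \<in> realization P" "z \<in> realization P"
  shows "path_dist P x z \<le> path_dist P x y + path_dist P y z"
proof (rule field_le_epsilon)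
  fix e :: real assume "0 < e"
  let ?d = "\<lambda>x y. setdist_sqcup (quot_fibre P x) (quot_fibre P y)"
  have "path_dist P x y < path_dist P x y + e / 2" using \<open>0 < e\<close> by simp
  then obtain n xs where xs: "1 \<le> n" "xs 0 = x" "xs n = y" "\<forall>i\<le>n. xs i \<in> realization P"
      "(\<Sum>i<n. ?d (xs i) (xs (Suc i))) < path_dist P x y + e / 2"
    unfolding path_dist_less_iff[OF R(1,2)] by blast
  have "path_dist P y z < path_dist P y z + e / 2" using \<open>0 < e\<close> by simp
  then obtain m ys where ys: "1 \<le> m" "ys 0 = y" "ys m = z" "\<forall>i\<le>m. ys i \<in> realization P"
      "(\<Sum>i<m. ?d (ys i) (ys (Suc i))) < path_dist P y z + e / 2"
    unfolding path_dist_less_iff[OF R(2,3)] by blast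
  \<comment> \<open>Concatenation of two nearly optimal paths. At index \<open>n\<close> both
    branches give \<open>y\<close>, so the second half can be read off as
    \<open>zs (n + i) = ys i\<close> even for \<open>i = 0\<close>.\<close>
  define zs where "zs i = (if i \<le> n then xs i else ys (i - n))" for i
  have split: "(\<Sum>i<n + m. f i) = (\<Sum>i<n. f i) + (\<Sum>i<m. f (n + i))" for f :: "nat \<Rightarrow> real"
    by (induction m) auto
  have right: "zs (n + i) = ys i" for i using xs(3) ys(2) by (simp add: zs_def)
  have "(\<Sum>i<n. ?d (zs i) (zs (Suc i))) = (\<Sum>i<n. ?d (xs i) (xs (Suc i)))"
    by (intro sum.cong) (auto simp: zs_def)
  moreover have "(\<Sum>i<m. ?d (zs (n + i)) (zs (Suc (n + i)))) = (\<Sum>i<m. ?d (ys i) (ys (Suc i)))"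
    using right[of "Suc _"] by (intro sum.cong) (auto simp: right)
  ultimately have "(\<Sum>i<n + m. ?d (zs i) (zs (Suc i))) < path_dist P x y + path_dist P y z + e"
    unfolding split using xs(5) ys(5) by simp
  moreover have "zs 0 = x" "zs (n + m) = z" using xs ys right by (simp_all add: zs_def)
  moreover have "\<forall>i\<le>n + m. zs i \<in> realization P" using xs ys by (auto simp: zs_def)
  moreover have "1 \<le> n + m" using xs by simp
  ultimately have "path_dist P x z < path_dist P x y + path_dist P y z + e"
    unfolding path_dist_less_iff[OF R(1,3)] by blast
  then show "path_dist P x z \<le> path_dist P x y + path_dist P y z + e" by simp
qed

lemma path_dist_le_close:
  assumes "close_in_simplex P e x y"
  shows "path_dist P x y \<le> e"
proof -
  obtain a b where "a \<in> quot_fibre P x" "b \<in> quot_fibre P y" "dist_sqcup a b \<le> e"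
    using close_in_simplex_lift[OF assms] .
  then show ?thesis
    using path_dist_le_setdist_sqcup[OF close_in_simplex_realization[OF assms]]
      setdist_sqcup_le by fastforce
qed

text \<open>Nonnegativity and separation of points are inherited from the smaller metric
  \<open>sup_dist\<close>.\<close>

lemma Metric_space_path_dist: "Metric_space (realization P) (path_dist P)"
proof
  show "0 \<le> path_dist P x y" for x y
  proof (cases "x \<in> realization P \<and> y \<in> realization P")
    case True
    then show ?thesis using sup_dist_nonneg sup_dist_le_path_dist order_trans by blast
  qed (auto simp: path_dist_def)
  show "path_dist P x y = 0 \<longleftrightarrow> x = y" if R: "x \<in> realization P" "y \<in> realization P" for x y
  proof
    assume "path_dist P x y = 0"
    then show "x = y" using sup_dist_eq_0[OF R] sup_dist_le_path_dist[OF R] by simp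
  next
    assume "x = y"
    \<comment> \<open>A path has at least one step; the constant step at \<open>x\<close> has length
      0 because it lifts to a single simplex.\<close>
    obtain C where "C \<in> fin_chains P" "x \<in> convex hull (vertex P ` C)"
      using R by (auto simp: realization_def)
    then have "close_in_simplex P 0 x x" by (auto simp: close_in_simplex_def)
    from path_dist_le_close[OF this] show "path_dist P x y = 0"
      using sup_dist_le_path_dist[OF R] sup_dist_nonneg[OF R] \<open>x = y\<close> by simp
  qed
qed (auto simp: path_dist_commute path_dist_triangle)

section \<open>Comparison of the uniformities\<close>

text \<open>The basic entourages shrink with \<open>e\<close>, so they form a filter base and a
  single one suffices.\<close>

lemma eventually_metric_uniformity:
  "eventually E (metric_uniformity X d) \<longleftrightarrow>
    (\<exists>e>0. \<forall>x\<in>X. \<forall>y\<in>X. d x y < e \<longrightarrow> E (x, y))"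
proof -
  have "eventually E (metric_uniformity X d) \<longleftrightarrow>
      (\<exists>e\<in>{0<..}. eventually E (principal {(x, y). x \<in> X \<and> y \<in> X \<and> d x y < e}))"
    unfolding metric_uniformity_def
  proof (rule eventually_INF_base)
    fix a b :: real assume "a \<in> {0<..}" "b \<in> {0<..}"
    then show "\<exists>e\<in>{0<..}. principal {(x, y). x \<in> X \<and> y \<in> X \<and> d x y < e} \<le>
        inf (principal {(x, y). x \<in> X \<and> y \<in> X \<and> d x y < a})
          (principal {(x, y). x \<in> X \<and> y \<in> X \<and> d x y < b})"
      by (intro bexI[of _ "min a b"]) auto
  qed auto
  then show ?thesis by (auto simp: eventually_principal)
qed

lemma uniform_structure_metric_uniformity:
  assumes zero: "\<And>x. x \<in> X \<Longrightarrow> d x x = 0"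
    and commute: "\<And>x y. d x y = d y x"
    and triangle: "\<And>x y z. x \<in> X \<Longrightarrow> y \<in> X \<Longrightarrow> z \<in> X \<Longrightarrow> d x z \<le> d x y + d y z"
  shows "uniform_structure X (metric_uniformity X d)"
  unfolding uniform_structure_def
proof (intro conjI allI impI)
  show "metric_uniformity X d \<le> principal (X \<times> X)"
    by (auto simp: le_principal eventually_metric_uniformity intro: exI[of _ 1])
  fix E assume "eventually E (metric_uniformity X d)"
  then obtain e where e: "0 < e" "\<And>x y. x \<in> X \<Longrightarrow> y \<in> X \<Longrightarrow> d x y < e \<Longrightarrow> E (x, y)"
    by (auto simp: eventually_metric_uniformity)
  show "\<forall>x\<in>X. E (x, x)" using e zero by simp
  show "eventually (\<lambda>(x, y). E (y, x)) (metric_uniformity X d)"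
    using e commute by (auto simp: eventually_metric_uniformity intro!: exI[of _ e])
  show "\<exists>D. eventually D (metric_uniformity X d) \<and>
      (\<forall>x y z. D (x, y) \<longrightarrow> D (y, z) \<longrightarrow> E (x, z))"
  proof (intro exI conjI allI impI)
    let ?D = "\<lambda>(x, y). x \<in> X \<and> y \<in> X \<and> d x y < e / 2"
    show "eventually ?D (metric_uniformity X d)"
      using e(1) by (auto simp: eventually_metric_uniformity intro!: exI[of _ "e / 2"])
    show "E (x, z)" if "?D (x, y)" "?D (y, z)" for x y z
      using that e(2)[of x z] triangle[of x y z] by simp
  qed
qed

lemma unif_continuous_quot_map:
  "unif_continuous (metric_uniformity (realization_sqcup P) dist_sqcup)
     (metric_uniformity (realization P) (sup_dist P)) (quot_map P)"
  unfolding unif_continuous_def filterlim_iff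
proof (intro allI impI)
  fix E assume "eventually E (metric_uniformity (realization P) (sup_dist P))"
  then obtain e where e: "0 < e"
      "\<And>x y. x \<in> realization P \<Longrightarrow> y \<in> realization P \<Longrightarrow> sup_dist P x y < e \<Longrightarrow> E (x, y)"
    by (auto simp: eventually_metric_uniformity)
  have "E (quot_map P a, quot_map P b)"
    if "a \<in> realization_sqcup P" "b \<in> realization_sqcup P" "dist_sqcup a b < e" for a b
    using that sup_dist_le_dist_sqcup[OF that(1,2)]
    by (intro e(2) quot_map_realization) auto
  then show "eventually (\<lambda>p. E (case p of (a, b) \<Rightarrow> (quot_map P a, quot_map P b)))
      (metric_uniformity (realization_sqcup P) dist_sqcup)"
    using e(1) by (auto simp: eventually_metric_uniformity intro!: exI[of _ e] simp del: quot_map.simps)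
qed

text \<open>The epsilon-delta form of \<open>three_steps\<close>: \<open>r\<close> depends on
  \<open>e\<close> alone. Both comparisons with the sup-metric rest on this uniformity.\<close>

lemma three_steps_uniform:
  fixes P :: "'a::order set"
  assumes "0 < e"
  obtains r where "0 < r"
    "\<And>x y. x \<in> realization P \<Longrightarrow> y \<in> realization P \<Longrightarrow> sup_dist P x y < r \<Longrightarrow>
      \<exists>x' y'. close_in_simplex P e x x' \<and> close_in_simplex P e x' y' \<and> close_in_simplex P e y' y"
proof -
  obtain n :: nat where n: "0 < n" "inverse (real n) < e / 2"
    using ex_inverse_of_nat_less[of "e / 2"] assms by auto
  then have "2 / real n \<le> e" by (simp add: field_simps)
  then have mono: "close_in_simplex P e x y" if "close_in_simplex P (2 / real n) x y" for x y
    using that unfolding close_in_simplex_def by (meson order_trans)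
  show thesis
  proof (rule that[of "1 / (2 * real n)"])
    fix x y assume xy: "x \<in> realization P" "y \<in> realization P" "sup_dist P x y < 1 / (2 * real n)"
    have "\<bar>x s - y s\<bar> \<le> 1 / (2 * real n)" if "s \<in> P" for s
      using sup_dist_upper[OF xy(1,2) that] xy(3) by linarith
    from three_steps[OF xy(1,2) n(1) this] mono
    show "\<exists>x' y'. close_in_simplex P e x x' \<and> close_in_simplex P e x' y' \<and> close_in_simplex P e y' y"
      by blast
  qed (use n in simp)
qed

lemma metric_uniformity_path_dist:
  "metric_uniformity (realization P) (path_dist P) = metric_uniformity (realization P) (sup_dist P)"
proof (rule antisym; rule filter_leI; unfold eventually_metric_uniformity)
  fix E
  assume "\<exists>e>0. \<forall>x\<in>realization P. \<forall>y\<in>realization P. sup_dist P x y < e \<longrightarrow> E (x, y)"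
  then show "\<exists>e>0. \<forall>x\<in>realization P. \<forall>y\<in>realization P. path_dist P x y < e \<longrightarrow> E (x, y)"
    using sup_dist_le_path_dist by (meson le_less_trans)
next
  fix E
  assume "\<exists>e>0. \<forall>x\<in>realization P. \<forall>y\<in>realization P. path_dist P x y < e \<longrightarrow> E (x, y)"
  then obtain e where e: "0 < e"
      "\<And>x y. x \<in> realization P \<Longrightarrow> y \<in> realization P \<Longrightarrow> path_dist P x y < e \<Longrightarrow> E (x, y)"
    by blast
  \<comment> \<open>Each of the three steps contributes at most \<open>e / 4\<close>, leaving the
    total of \<open>3 * e / 4\<close> strictly below \<open>e\<close>.\<close>
  then have "0 < e / 4" by simp
  then obtain r where r: "0 < r" "\<And>x y. x \<in> realization P \<Longrightarrow> y \<in> realization P \<Longrightarrow>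
      sup_dist P x y < r \<Longrightarrow> \<exists>x' y'. close_in_simplex P (e / 4) x x' \<and>
        close_in_simplex P (e / 4) x' y' \<and> close_in_simplex P (e / 4) y' y"
    using three_steps_uniform by blast
  have "path_dist P x y < e"
    if R: "x \<in> realization P" "y \<in> realization P" and d: "sup_dist P x y < r" for x y
  proof -
    obtain x' y' where steps: "close_in_simplex P (e / 4) x x'" "close_in_simplex P (e / 4) x' y'"
        "close_in_simplex P (e / 4) y' y"
      using r(2)[OF R d] by blast
    note R' = close_in_simplex_realization[OF steps(2)]
    have "path_dist P x y \<le> path_dist P x x' + (path_dist P x' y' + path_dist P y' y)"
      using path_dist_triangle[OF R(1) R'(1) R(2)] path_dist_triangle[OF R' R(2)] by linarith
    also have "\<dots> \<le> e / 4 + (e / 4 + e / 4)"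
      using steps by (intro add_mono path_dist_le_close)
    finally show ?thesis using e(1) by simp
  qed
  then show "\<exists>r>0. \<forall>x\<in>realization P. \<forall>y\<in>realization P. sup_dist P x y < r \<longrightarrow> E (x, y)"
    using r(1) e(2) by blast
qed

text \<open>Uniform continuity of \<open>q\<close> puts every sufficiently short step inside a
  simplex into a prescribed entourage of \<open>W\<close>. Points close in the sup-metric are joined
  by three such steps, so a composition of entourages contains the pair.\<close>

lemma metric_uniformity_sup_dist_finest:
  assumes W: "uniform_structure (realization P) W"
    and cont: "unif_continuous (metric_uniformity (realization_sqcup P) dist_sqcup) W (quot_map P)"
  shows "metric_uniformity (realization P) (sup_dist P) \<le> W"
proof (rule filter_leI)
  fix E assume E: "eventually E W"
  have halve: "\<exists>D. eventually D W \<and> (\<forall>x y z. D (x, y) \<longrightarrow> D (y, z) \<longrightarrow> E (x, z))"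
    if "eventually E W" for E
    using W that unfolding uniform_structure_def by blast
  \<comment> \<open>Halving \<open>E\<close> twice gives a \<open>D\<close> whose fourfold
    composition lies in \<open>E\<close>. Three factors are the three steps, and reflexivity of
    \<open>D\<close> at the endpoint supplies the fourth.\<close>
  obtain D1 where D1: "eventually D1 W" "\<And>x y z. D1 (x, y) \<Longrightarrow> D1 (y, z) \<Longrightarrow> E (x, z)"
    using halve[OF E] by blast
  obtain D where D: "eventually D W" "\<And>x y z. D (x, y) \<Longrightarrow> D (y, z) \<Longrightarrow> D1 (x, z)"
    using halve[OF D1(1)] by blast
  have refl: "D (x, x)" if "x \<in> realization P" for x
    using W D(1) that unfolding uniform_structure_def by blast
  have "eventually (\<lambda>p. D (case p of (a, b) \<Rightarrow> (quot_map P a, quot_map P b)))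
      (metric_uniformity (realization_sqcup P) dist_sqcup)"
    using cont D(1) unfolding unif_continuous_def filterlim_iff by blast
  then obtain e where e: "0 < e" "\<And>a b. a \<in> realization_sqcup P \<Longrightarrow> b \<in> realization_sqcup P \<Longrightarrow>
      dist_sqcup a b < e \<Longrightarrow> D (quot_map P a, quot_map P b)"
    unfolding eventually_metric_uniformity by auto
  \<comment> \<open>A lifted step has length at most \<open>e / 2\<close>, which meets the strict
    bound \<open>e\<close> of uniform continuity.\<close>
  have step: "D (x, y)" if close: "close_in_simplex P (e / 2) x y" for x y
  proof -
    obtain a b where "a \<in> quot_fibre P x" "b \<in> quot_fibre P y" "dist_sqcup a b \<le> e / 2"
      using close_in_simplex_lift[OF close] .
    then show ?thesis using e(1) e(2)[of a b] by (auto simp: quot_fibre_def simp del: quot_map.simps)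
  qed
  have "0 < e / 2" using e(1) by simp
  then obtain r where r: "0 < r" "\<And>x y. x \<in> realization P \<Longrightarrow> y \<in> realization P \<Longrightarrow>
      sup_dist P x y < r \<Longrightarrow> \<exists>x' y'. close_in_simplex P (e / 2) x x' \<and>
        close_in_simplex P (e / 2) x' y' \<and> close_in_simplex P (e / 2) y' y"
    using three_steps_uniform by blast
  have "E (x, y)"
    if "x \<in> realization P" "y \<in> realization P" "sup_dist P x y < r" for x y
    using r(2)[OF that] step refl[OF that(2)] D1(2) D(2) by metis
  then show "eventually E (metric_uniformity (realization P) (sup_dist P))"
    using r(1) by (auto simp: eventually_metric_uniformity)
qed

theorem theorem1:
  fixes P :: "'a::order set"
  assumes "countable P"
  shows "Metric_space (realization P) (path_dist P) \<and>
    is_quotient_uniformity (metric_uniformity (realization_sqcup P) dist_sqcup)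
      (quot_map P) (realization P) (metric_uniformity (realization P) (sup_dist P)) \<and>
    metric_uniformity (realization P) (path_dist P) =
      metric_uniformity (realization P) (sup_dist P)"
proof -
  have "uniform_structure (realization P) (metric_uniformity (realization P) (sup_dist P))"
    by (rule uniform_structure_metric_uniformity)
      (fact sup_dist_self sup_dist_commute sup_dist_triangle)+
  then show ?thesis
    unfolding is_quotient_uniformity_def
    using Metric_space_path_dist metric_uniformity_path_dist unif_continuous_quot_map
      metric_uniformity_sup_dist_finest by blast
qed

end
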